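(* Let $\mathbb{D}$ denote the unit disc, and let $\Omega$ be a bounded simply connected quadrature domain in $\mathbb{C}$ containing the origin. If $f$ is a conformal map $\mathbb{D}\to\Omega$ (that is, a biholomorphism of $\mathbb{D}$ onto $\Omega$) such that $f(0)=0$, then there is a homotopy $\varphi_t(z)$, $0\le t\le1$, $z\in\mathbb{D}$, with $\varphi_0(z)=f'(0)z$, $\varphi_1(z)=f(z)$, and each $\varphi_t(\mathbb{D})$ a quadrature domain. Consequently, any two bounded simply connected quadrature domains in $\mathbb{C}$ can be continuously deformed into one another in such a way that each intermediate shape is again a simply connected quadrature domain.
   Context: A domain is a nonempty connected open set. For a domain $\Omega\subset\mathbb{C}$, $H^2(\Omega)$ is the Bergman space of holomorphic functions on $\Omega$ square-integrable with respect to area measure. $\Omega$ is a quadrature domain (for $H^2$ functions) if there exist finitely many points $z_k\in\Omega$ and constants $c_{jk}$ (finitely many) with $\int_\Omega f\,dA=\sum_{j,k}c_{jk}f^{(j)}(z_k)$ for all $f\in H^2(\Omega)$. A homotopy $\varphi_t(z)$ is a map $(t,z)\mapsto\varphi_t(z)\in\mathbb{C}$ continuous on $[0,1]\times\mathbb{D}$. A continuous deformation of $\Omega_1$ into $\Omega_2$ is a continuous map $\Phi:[0,1]\times\Omega_1\to\mathbb{C}$ with $\Phi(0,\cdot)$ the identity and $\Phi(1,\Omega_1)=\Omega_2$; its intermediate shapes are the sets $\Phi(t,\Omega_1)$. *)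

theory Defs
  imports "HOL-Complex_Analysis.Complex_Analysis"
begin

definition domain :: "complex set \<Rightarrow> bool" where
  "domain \<Omega> \<longleftrightarrow> open \<Omega> \<and> connected \<Omega> \<and> \<Omega> \<noteq> {}"

text \<open>
  The Bergman space consists of total functions, of which only the restriction to \<open>\<Omega>\<close>
  matters. Area measure is \<^term>\<open>lborel :: complex measure\<close>.
\<close>

definition bergman_space :: "complex set \<Rightarrow> (complex \<Rightarrow> complex) set" where
  "bergman_space \<Omega> =
     {f. f holomorphic_on \<Omega> \<and> set_integrable lborel \<Omega> (\<lambda>z. (norm (f z))\<^sup>2)}"

text \<open>
  Integrability is stated because the Bochner integral of a non-integrable function is \<open>0\<close>
  by convention. It is automatic when \<open>\<Omega>\<close> has finite area. The finitely many
  coefficients are indexed by nodes \<open>z \<in> Z\<close> and derivative orders \<open>j < N\<close>, padded with zeros.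
\<close>

definition quadrature_domain :: "complex set \<Rightarrow> bool" where
  "quadrature_domain \<Omega> \<longleftrightarrow> domain \<Omega> \<and>
     (\<exists>(Z :: complex set) (N :: nat) (c :: nat \<Rightarrow> complex \<Rightarrow> complex).
        finite Z \<and> Z \<subseteq> \<Omega> \<and>
        (\<forall>f\<in>bergman_space \<Omega>. set_integrable lborel \<Omega> f \<and>
           (LINT z:\<Omega>|lborel. f z) = (\<Sum>z\<in>Z. \<Sum>j<N. c j z * (deriv ^^ j) f z)))"

definition biholomorphism ::
    "(complex \<Rightarrow> complex) \<Rightarrow> complex set \<Rightarrow> complex set \<Rightarrow> bool" where
  "biholomorphism f S T \<longleftrightarrow>
     f holomorphic_on S \<and> bij_betw f S T \<and> inv_into S f holomorphic_on T"

definition disc_homotopy :: "(real \<Rightarrow> complex \<Rightarrow> complex) \<Rightarrow> bool" where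
  "disc_homotopy \<phi> \<longleftrightarrow> continuous_on ({0..1} \<times> ball 0 1) (\<lambda>(t, z). \<phi> t z)"

definition continuous_deformation ::
    "(real \<Rightarrow> complex \<Rightarrow> complex) \<Rightarrow> complex set \<Rightarrow> complex set \<Rightarrow> bool" where
  "continuous_deformation \<Phi> \<Omega>1 \<Omega>2 \<longleftrightarrow>
     continuous_on ({0..1} \<times> \<Omega>1) (\<lambda>(t, z). \<Phi> t z) \<and>
     (\<forall>z\<in>\<Omega>1. \<Phi> 0 z = z) \<and> \<Phi> 1 ` \<Omega>1 = \<Omega>2"

end

theory Submission
  imports Defs
begin

text \<open>
  Let \<open>f\<close> map the disc conformally onto \<open>\<Omega>\<close>. Pulling test functions back along \<open>f\<close> turns area
  integration over \<open>\<Omega>\<close> into the functional \<open>F \<mapsto> \<integral>\<^sub>D F \<cdot> cnj f'\<close> on the Bergman space of the disc, and \<open>\<Omega>\<close> is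
  a quadrature domain iff this functional is a finite combination of derivative evaluations. The
  dilated maps \<open>z \<mapsto> f 0 + (f (t z) - f 0) / t\<close> have derivative \<open>f' (t z)\<close>. Dilation \<open>F \<mapsto> F (t \<cdot>)\<close> is
  self-adjoint on the Bergman space, because monomials are orthogonal, so the functional of the
  dilated map is \<open>F \<mapsto> \<integral>\<^sub>D F (t \<cdot>) \<cdot> cnj f'\<close>, which is again a finite combination of derivative
  evaluations. In particular the rationality of \<open>f\<close> (the Aharonov-Shapiro theorem) is not used.

  For two domains, the first is shrunk to a disc by dilations, the disc is moved by affine maps to one
  associated with the second domain, and that disc is grown into the second domain.
\<close>


section \<open>Conformal change of variables\<close>

text \<open>
  The library's change of variables theorem is stated for \<^typ>\<open>real^'n\<close>, hence the detour through
  \<^typ>\<open>real^2\<close>.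
\<close>

definition to_vec :: "complex \<Rightarrow> real^2" where
  "to_vec z = (\<chi> i. if i = 1 then Re z else Im z)"

definition of_vec :: "real^2 \<Rightarrow> complex" where
  "of_vec v = Complex (v $ 1) (v $ 2)"

lemma of_vec_to_vec [simp]: "of_vec (to_vec z) = z"
  by (simp add: of_vec_def to_vec_def)

lemma to_vec_of_vec [simp]: "to_vec (of_vec v) = v"
  by (simp add: of_vec_def to_vec_def vec_eq_iff forall_2)

lemma scaleR_to_vec: "r *\<^sub>R to_vec z = to_vec (of_real r * z)"
  by (simp add: to_vec_def vec_eq_iff)

lemma linear_to_vec: "linear to_vec"
  by (rule linearI) (auto simp: to_vec_def vec_eq_iff)

lemma linear_of_vec: "linear of_vec"
  by (rule linearI) (auto simp: of_vec_def complex_eq_iff)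

lemma bounded_linear_to_vec: "bounded_linear to_vec"
  using linear_to_vec by (rule linear_conv_bounded_linear[THEN iffD1])

lemma bounded_linear_of_vec: "bounded_linear of_vec"
  using linear_of_vec by (rule linear_conv_bounded_linear[THEN iffD1])

lemma measurable_of_vec [measurable]: "of_vec \<in> borel_measurable borel"
  by (intro borel_measurable_continuous_onI linear_continuous_on bounded_linear_of_vec)

lemma to_vec_image: "to_vec ` S = of_vec -` S"
  by (auto simp: image_iff) (metis to_vec_of_vec)

lemma distr_of_vec: "distr lborel borel of_vec = lborel"
proof (rule lborel_eqI[symmetric])
  fix l u :: complex
  assume *: "\<And>b. b \<in> Basis \<Longrightarrow> l \<bullet> b \<le> u \<bullet> b"
  have le: "Re l \<le> Re u" "Im l \<le> Im u"
    using *[of 1] *[of \<i>] by (auto simp: Basis_complex_def)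
  have "of_vec -` box l u = box (to_vec l) (to_vec u)"
    by (auto simp: box_def Basis_complex_def to_vec_def of_vec_def Basis_vec_def inner_axis forall_2)
  then have "emeasure (distr lborel borel of_vec) (box l u) = emeasure lborel (box (to_vec l) (to_vec u))"
    by (simp add: emeasure_distr)
  also have "\<dots> = (\<Prod>b\<in>Basis. (to_vec u - to_vec l) \<bullet> b)"
    using le by (subst emeasure_lborel_box) (auto simp: Basis_vec_def inner_axis to_vec_def)
  also have "\<dots> = (\<Prod>b\<in>Basis. (u - l) \<bullet> b)"
  proof -
    have "(Basis :: (real^2) set) = {axis 1 1, axis 2 1}"
      by (auto simp: Basis_vec_def UNIV_2)
    then have "(\<Prod>b\<in>Basis. (to_vec u - to_vec l) \<bullet> b) =
        (\<Prod>b\<in>{axis 1 1, axis 2 1}. (to_vec u - to_vec l) \<bullet> b)"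
      by simp
    also have "\<dots> = (\<Prod>b\<in>Basis. (u - l) \<bullet> b)"
      by (simp add: Basis_complex_def to_vec_def inner_axis axis_eq_axis)
    finally show ?thesis
      by simp
  qed
  finally show "emeasure (distr lborel borel of_vec) (box l u) = (\<Prod>b\<in>Basis. (u - l) \<bullet> b)" .
qed auto

lemma lborel_complex_integral_via_vec:
  fixes k :: "complex \<Rightarrow> complex"
  assumes S: "open S" and k: "continuous_on S k"
  shows "set_integrable lborel S k \<longleftrightarrow> (\<lambda>v. to_vec (k (of_vec v))) absolutely_integrable_on to_vec ` S"
    and "set_integrable lborel S k \<Longrightarrow>
      integral (to_vec ` S) (\<lambda>v. to_vec (k (of_vec v))) = to_vec (LINT z:S|lborel. k z)"
proof -
  let ?k = "\<lambda>z. indicator S z *\<^sub>R k z"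
  let ?k' = "\<lambda>v. indicator (to_vec ` S) v *\<^sub>R k (of_vec v)"
  have k_meas: "?k \<in> borel_measurable borel"
    using S k by (intro borel_measurable_continuous_on_indicator) auto
  have k': "?k' = (\<lambda>v. ?k (of_vec v))"
    by (auto simp: to_vec_image indicator_def)
  have k'_meas: "?k' \<in> borel_measurable lborel"
    unfolding k' using k_meas by measurable
  have "set_integrable lborel S k \<longleftrightarrow> integrable (distr lborel borel of_vec) ?k"
    by (simp add: set_integrable_def distr_of_vec)
  also have "\<dots> \<longleftrightarrow> integrable lborel ?k'"
    unfolding k' using k_meas by (intro integrable_distr_eq) auto
  also have "\<dots> \<longleftrightarrow> (\<lambda>v. k (of_vec v)) absolutely_integrable_on to_vec ` S"
    using k'_meas by (simp add: set_integrable_def integrable_completion)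
  finally have eq1: "set_integrable lborel S k \<longleftrightarrow> (\<lambda>v. k (of_vec v)) absolutely_integrable_on to_vec ` S" .
  have to: "(\<lambda>v. to_vec (k (of_vec v))) absolutely_integrable_on to_vec ` S"
    if "(\<lambda>v. k (of_vec v)) absolutely_integrable_on to_vec ` S"
    using absolutely_integrable_linear[OF that bounded_linear_to_vec] by (simp add: o_def)
  moreover have "(\<lambda>v. k (of_vec v)) absolutely_integrable_on to_vec ` S"
    if "(\<lambda>v. to_vec (k (of_vec v))) absolutely_integrable_on to_vec ` S"
    using absolutely_integrable_linear[OF that bounded_linear_of_vec] by (simp add: o_def)
  ultimately show "set_integrable lborel S k \<longleftrightarrow> (\<lambda>v. to_vec (k (of_vec v))) absolutely_integrable_on to_vec ` S"
    using eq1 by blast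
  assume int: "set_integrable lborel S k"
  then have int': "(\<lambda>v. k (of_vec v)) absolutely_integrable_on to_vec ` S"
    using eq1 by simp
  have "(LINT z:S|lborel. k z) = integral\<^sup>L (distr lborel borel of_vec) ?k"
    by (simp add: set_lebesgue_integral_def distr_of_vec)
  also have "\<dots> = integral\<^sup>L lborel ?k'"
    unfolding k' using k_meas by (intro integral_distr) auto
  also have "\<dots> = integral\<^sup>L lebesgue ?k'"
    using k'_meas by (simp add: integral_completion)
  also have "\<dots> = integral (to_vec ` S) (\<lambda>v. k (of_vec v))"
    using set_lebesgue_integral_eq_integral(2)[OF int'] by (simp add: set_lebesgue_integral_def)
  finally have "(LINT z:S|lborel. k z) = integral (to_vec ` S) (\<lambda>v. k (of_vec v))" .
  then show "integral (to_vec ` S) (\<lambda>v. to_vec (k (of_vec v))) = to_vec (LINT z:S|lborel. k z)"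
    using integral_linear[OF set_lebesgue_integral_eq_integral(1)[OF int'] bounded_linear_to_vec]
    by (simp add: o_def)
qed

lemma det_matrix_complex_mult:
  "det (matrix (\<lambda>v. to_vec (a * of_vec v))) = (norm a)\<^sup>2"
  by (simp add: det_2 matrix_def to_vec_def of_vec_def axis_def cmod_power2) (simp add: power2_eq_square)

lemma conformal_change_of_variables:
  fixes h :: "complex \<Rightarrow> complex"
  assumes S: "open S" and g: "g holomorphic_on S" and inj: "inj_on g S"
    and h: "continuous_on (g ` S) h"
  shows "set_integrable lborel (g ` S) h \<longleftrightarrow>
      set_integrable lborel S (\<lambda>z. of_real ((norm (deriv g z))\<^sup>2) * h (g z))" (is ?int)
    and "set_integrable lborel (g ` S) h \<Longrightarrow>
      (LINT w:g ` S|lborel. h w) = (LINT z:S|lborel. of_real ((norm (deriv g z))\<^sup>2) * h (g z))"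
proof -
  let ?G = "\<lambda>v. to_vec (g (of_vec v))" and ?S = "to_vec ` S"
  let ?H = "\<lambda>v. to_vec (h (of_vec v))"
  let ?k = "\<lambda>z. of_real ((norm (deriv g z))\<^sup>2) * h (g z)"
  have gS: "open (g ` S)"
    using open_mapping_thm3[OF g S inj] .
  have img: "?G ` ?S = to_vec ` (g ` S)"
    by (auto simp: image_iff)
  have k: "continuous_on S ?k"
    by (intro continuous_intros continuous_on_compose2[OF h] holomorphic_on_imp_continuous_on
        holomorphic_deriv g S) auto
  have open_S': "open ?S"
    unfolding to_vec_image
    by (intro open_vimage S linear_continuous_on bounded_linear_of_vec)
  have der: "(?G has_derivative (\<lambda>v. to_vec (deriv g (of_vec x) * of_vec v))) (at x within ?S)"
    if "x \<in> ?S" for x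
  proof -
    have "(g has_field_derivative deriv g (of_vec x)) (at (of_vec x))"
      using that g S by (auto simp: holomorphic_derivI)
    then have "(g has_derivative (\<lambda>u. deriv g (of_vec x) * u)) (at (of_vec x))"
      by (simp add: has_field_derivative_def)
    from has_derivative_compose[OF bounded_linear_imp_has_derivative[OF bounded_linear_of_vec] this]
    have "((\<lambda>v. g (of_vec v)) has_derivative (\<lambda>v. deriv g (of_vec x) * of_vec v)) (at x within ?S)"
      by simp
    from bounded_linear.has_derivative[OF bounded_linear_to_vec this] show ?thesis .
  qed
  have inj': "inj_on ?G ?S"
    using inj by (auto simp: inj_on_def) (metis of_vec_to_vec)
  have eq: "\<bar>det (matrix (\<lambda>v. to_vec (deriv g (of_vec x) * of_vec v)))\<bar> *\<^sub>R ?H (?G x) = to_vec (?k (of_vec x))" for x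
    by (simp only: det_matrix_complex_mult abs_power2 scaleR_to_vec of_vec_to_vec)
  note cov = has_absolute_integral_change_of_variables[OF _ der inj', of ?H, unfolded eq img]
  have S_leb: "?S \<in> sets lebesgue"
    using open_S' by (simp add: lmeasurable_iff_integrable_on borel_open)
  show ?int
    unfolding lborel_complex_integral_via_vec(1)[OF gS h] lborel_complex_integral_via_vec(1)[OF S k]
    using cov[OF S_leb] by blast
  assume int: "set_integrable lborel (g ` S) h"
  then have int': "set_integrable lborel S ?k"
    using \<open>?int\<close> by blast
  have "to_vec (LINT w:g ` S|lborel. h w) = integral (to_vec ` (g ` S)) ?H"
    using lborel_complex_integral_via_vec(2)[OF gS h int] by simp
  also have "\<dots> = integral ?S (\<lambda>v. to_vec (?k (of_vec v)))"
    using cov[OF S_leb] int' lborel_complex_integral_via_vec(1)[OF S k] by blast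
  also have "\<dots> = to_vec (LINT z:S|lborel. ?k z)"
    by (rule lborel_complex_integral_via_vec(2)[OF S k int'])
  finally have "of_vec (to_vec (LINT w:g ` S|lborel. h w)) = of_vec (to_vec (LINT z:S|lborel. ?k z))"
    by (rule arg_cong)
  then show "(LINT w:g ` S|lborel. h w) = (LINT z:S|lborel. ?k z)"
    by (simp only: of_vec_to_vec)
qed

section \<open>Orthogonality on the disc\<close>

text \<open>Rotating by an angle that multiplies the integrand by \<open>-1\<close> shows that the integral vanishes.\<close>

lemma disc_monomials_orthogonal:
  assumes "m \<noteq> n"
  shows "(LINT z:ball 0 r|lborel. z ^ m * cnj (z ^ n)) = 0"
proof -
  define \<omega> where "\<omega> = cis (pi / (real m - real n))"
  have \<omega>: "norm \<omega> = 1"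
    by (simp add: \<omega>_def)
  then have \<omega>0: "\<omega> \<noteq> 0"
    by auto
  have "\<omega> ^ m * cnj (\<omega> ^ n) = cis (real m * (pi / (real m - real n)) + - (real n * (pi / (real m - real n))))"
    by (simp only: \<omega>_def Complex.DeMoivre cis_cnj cis_mult)
  also have "real m * (pi / (real m - real n)) + - (real n * (pi / (real m - real n))) = pi"
  proof -
    have "real m * (pi / (real m - real n)) + - (real n * (pi / (real m - real n))) =
        (real m - real n) * (pi / (real m - real n))"
      by (simp only: left_diff_distrib)
    then show ?thesis
      using assms by simp
  qed
  finally have neg: "\<omega> ^ m * cnj (\<omega> ^ n) = -1"
    by simp
  let ?h = "\<lambda>z. z ^ m * cnj (z ^ n)"
  have "z \<in> (*) \<omega> ` ball 0 r" if "z \<in> ball 0 r" for z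
    using that \<omega> \<omega>0 by (intro image_eqI[of _ _ "z / \<omega>"]) (auto simp: norm_divide)
  then have img: "(*) \<omega> ` ball 0 r = ball 0 r"
    using \<omega> by (auto simp: norm_mult)
  have int: "set_integrable lborel (ball 0 r) ?h"
    by (rule set_integrable_subset[of _ "cball 0 r"])
      (auto simp: set_integrable_def intro!: borel_integrable_compact continuous_intros)
  have "(LINT z:(*) \<omega> ` ball 0 r|lborel. ?h z) = (LINT z:ball 0 r|lborel. of_real ((norm (deriv ((*) \<omega>) z))\<^sup>2) * ?h (\<omega> * z))"
    using int \<omega>0 by (intro conformal_change_of_variables) (auto intro!: holomorphic_intros continuous_intros simp: img inj_on_def)
  also have "\<dots> = (LINT z:ball 0 r|lborel. (\<omega> ^ m * cnj (\<omega> ^ n)) * ?h z)"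
    by (intro set_lebesgue_integral_cong) (auto simp: \<omega> power_mult_distrib)
  also have "\<dots> = - (LINT z:ball 0 r|lborel. ?h z)"
    by (simp only: neg set_integral_mult_right) simp
  finally show ?thesis
    by (simp add: img)
qed

lemma disc_integral_power_series_mult:
  fixes H :: "complex \<Rightarrow> complex"
  assumes F: "\<And>z. norm z < 1 \<Longrightarrow> (\<lambda>n. a n * z ^ n) sums F z"
    and H: "continuous_on (cball 0 r) H" and r: "0 < r" "r < 1"
  shows "(\<lambda>n. a n * (LINT z:ball 0 r|lborel. z ^ n * H z)) sums (LINT z:ball 0 r|lborel. F z * H z)"
proof -
  obtain B where B: "\<And>z. z \<in> cball 0 r \<Longrightarrow> norm (H z) \<le> B"
    using compact_imp_bounded[OF compact_continuous_image[OF H compact_cball]]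
    unfolding bounded_iff by blast
  then have B0: "B \<ge> 0"
    using r norm_ge_zero[of "H 0"] by (meson centre_in_cball less_imp_le order_trans)
  obtain s where s: "r < s" "s < 1"
    using dense r by blast
  have sum: "summable (\<lambda>n. norm (a n * of_real r ^ n))"
    using r s by (intro powser_insidea[of a "of_real s"] sums_summable[OF F]) auto
  let ?f = "\<lambda>n z. indicator (ball 0 r) z *\<^sub>R (a n * z ^ n * H z)"
  have bound: "norm (?f n z) \<le> norm (a n * of_real r ^ n) * B * indicator (ball 0 r) z" for n z
    using r B B0
    by (auto simp: norm_mult norm_power indicator_def intro!: mult_mono power_mono mult_nonneg_nonneg)
  have int: "integrable lborel (?f n)" for n
  proof -
    have "set_integrable lborel (cball 0 r) (\<lambda>z. a n * z ^ n * H z)"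
      unfolding set_integrable_def by (intro borel_integrable_compact continuous_intros H) auto
    then have "set_integrable lborel (ball 0 r) (\<lambda>z. a n * z ^ n * H z)"
      by (rule set_integrable_subset) auto
    then show ?thesis
      by (simp add: set_integrable_def)
  qed
  have ball_int: "integrable lborel (indicator (ball 0 r) :: complex \<Rightarrow> real)"
    using emeasure_lborel_ball_finite[of "0::complex" r] by (intro integrable_real_indicator) auto
  have sumf: "summable (\<lambda>n. norm (?f n z))" for z
    by (rule summable_comparison_test'[OF summable_mult2[OF sum, of "B * indicator (ball 0 r) z"], of 0])
      (use bound in \<open>auto simp: mult.assoc\<close>)
  have "(\<lambda>n. integral\<^sup>L lborel (?f n)) sums (\<integral>z. (\<Sum>n. ?f n z) \<partial>lborel)"
  proof (rule sums_integral[OF int])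
    show "AE z in lborel. summable (\<lambda>n. norm (?f n z))"
      using sumf by blast
    have "norm (\<integral>z. norm (?f n z) \<partial>lborel) \<le> norm (a n * of_real r ^ n) * (B * (\<integral>z. indicator (ball 0 r) (z::complex) \<partial>lborel))" for n
    proof -
      have "(\<integral>z. norm (?f n z) \<partial>lborel) \<le> (\<integral>z. norm (a n * of_real r ^ n) * B * indicator (ball 0 r) (z::complex) \<partial>lborel)"
      proof (rule Bochner_Integration.integral_mono)
        show "integrable lborel (\<lambda>z. norm (?f n z))"
          by (rule integrable_norm[OF int])
        show "integrable lborel (\<lambda>z. norm (a n * of_real r ^ n) * B * indicator (ball 0 r) (z::complex))"
          by (rule integrable_mult_right[OF ball_int])
      qed (rule bound)
      then show ?thesis
        by (simp add: mult.assoc)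
    qed
    then show "summable (\<lambda>n. \<integral>z. norm (?f n z) \<partial>lborel)"
      by (intro summable_comparison_test'[OF summable_mult2[OF sum], of 0]) auto
  qed
  moreover have "(\<Sum>n. ?f n z) = indicator (ball 0 r) z *\<^sub>R (F z * H z)" for z
  proof (cases "z \<in> ball 0 r")
    case True
    then have "(\<lambda>n. a n * z ^ n * H z) sums (F z * H z)"
      using r by (intro sums_mult2 F) auto
    then show ?thesis
      using True by (simp add: sums_iff)
  qed auto
  moreover have "integral\<^sup>L lborel (?f n) = a n * (LINT z:ball 0 r|lborel. z ^ n * H z)" for n
    by (simp add: set_lebesgue_integral_def mult.assoc flip: mult_scaleR_right)
  ultimately show ?thesis
    by (simp add: set_lebesgue_integral_def)
qed

lemma set_lebesgue_integral_cnj: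
  "(LINT x:A|M. cnj (f x)) = cnj (LINT x:A|M. f x)"
  by (simp add: set_lebesgue_integral_def complex_cnj_scaleR[symmetric] del: complex_cnj_scaleR)

lemma disc_inner_product_sums:
  assumes F: "\<And>z. norm z < 1 \<Longrightarrow> (\<lambda>n. a n * z ^ n) sums F z"
    and G: "\<And>z. norm z < 1 \<Longrightarrow> (\<lambda>n. b n * z ^ n) sums G z"
    and r: "0 < r" "r < 1"
  shows "(\<lambda>n. a n * cnj (b n) * (LINT z:ball 0 r|lborel. z ^ n * cnj (z ^ n))) sums
    (LINT z:ball 0 r|lborel. F z * cnj (G z))"
proof -
  have G_cont: "continuous_on (cball 0 r) G"
  proof -
    have "G holomorphic_on ball 0 1"
      using G by (intro power_series_holomorphic[of 0 1 b]) auto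
    then show ?thesis
      using r by (intro holomorphic_on_imp_continuous_on) (auto elim!: holomorphic_on_subset)
  qed
  have mono: "(LINT z:ball 0 r|lborel. z ^ n * cnj (G z)) =
      cnj (b n) * (LINT z:ball 0 r|lborel. z ^ n * cnj (z ^ n))" for n
  proof -
    have "(\<lambda>m. b m * (LINT z:ball 0 r|lborel. z ^ m * cnj (z ^ n))) sums
        (LINT z:ball 0 r|lborel. G z * cnj (z ^ n))"
      by (intro disc_integral_power_series_mult[OF G _ r] continuous_intros) auto
    moreover have "(\<lambda>m. b m * (LINT z:ball 0 r|lborel. z ^ m * cnj (z ^ n))) sums
        (b n * (LINT z:ball 0 r|lborel. z ^ n * cnj (z ^ n)))"
      using sums_single[of n "\<lambda>m. b m * (LINT z:ball 0 r|lborel. z ^ m * cnj (z ^ n))"]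
      by (rule sums_cong[THEN iffD1, rotated]) (auto simp: disc_monomials_orthogonal simp del: complex_cnj_power)
    ultimately have G_eq: "(LINT z:ball 0 r|lborel. G z * cnj (z ^ n)) = b n * (LINT z:ball 0 r|lborel. z ^ n * cnj (z ^ n))"
      by (rule sums_unique2)
    have "(LINT z:ball 0 r|lborel. z ^ n * cnj (G z)) = (LINT z:ball 0 r|lborel. cnj (G z * cnj (z ^ n)))"
      by (simp add: mult.commute)
    also have "\<dots> = cnj (b n * (LINT z:ball 0 r|lborel. z ^ n * cnj (z ^ n)))"
      by (simp only: set_lebesgue_integral_cnj G_eq)
    also have "\<dots> = cnj (b n) * (LINT z:ball 0 r|lborel. cnj (z ^ n * cnj (z ^ n)))"
      by (simp only: set_lebesgue_integral_cnj complex_cnj_mult[of "b n"])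
    also have "(\<lambda>z. cnj (z ^ n * cnj (z ^ n))) = (\<lambda>z. z ^ n * cnj (z ^ n))"
      by (simp add: mult.commute)
    finally show ?thesis .
  qed
  have "(\<lambda>n. a n * (LINT z:ball 0 r|lborel. z ^ n * cnj (G z))) sums (LINT z:ball 0 r|lborel. F z * cnj (G z))"
    by (intro disc_integral_power_series_mult[OF F _ r] continuous_intros G_cont)
  then show ?thesis
    by (simp add: mono mult.assoc)
qed

lemma disc_dilation_selfadjoint_smaller:
  fixes t :: real
  assumes F: "F holomorphic_on ball 0 1" and G: "G holomorphic_on ball 0 1"
    and t: "0 \<le> t" "t \<le> 1" and r: "0 < r" "r < 1"
  shows "(LINT z:ball 0 r|lborel. F (of_real t * z) * cnj (G z)) =
    (LINT z:ball 0 r|lborel. F z * cnj (G (of_real t * z)))"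
proof -
  define a b where "a n = (deriv ^^ n) F 0 / fact n" and "b n = (deriv ^^ n) G 0 / fact n" for n
  have Fs: "(\<lambda>n. a n * z ^ n) sums F z" and Gs: "(\<lambda>n. b n * z ^ n) sums G z" if "norm z < 1" for z
    using holomorphic_power_series[OF F, of z] holomorphic_power_series[OF G, of z] that
    by (auto simp: a_def b_def)
  have tz: "norm (of_real t * z) < 1" if "norm z < 1" for z :: complex
    using that t mult_left_le_one_le[of "norm z" t] by (simp add: norm_mult)
  have Fts: "(\<lambda>n. (a n * of_real t ^ n) * z ^ n) sums F (of_real t * z)"
    and Gts: "(\<lambda>n. (b n * of_real t ^ n) * z ^ n) sums G (of_real t * z)" if "norm z < 1" for z
    using Fs[OF tz[OF that]] Gs[OF tz[OF that]] by (simp_all add: power_mult_distrib mult_ac)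
  show ?thesis
    using sums_unique2[OF disc_inner_product_sums[OF Fts Gs r]] disc_inner_product_sums[OF Fs Gts r]
    by (simp add: mult_ac)
qed

section \<open>Bergman spaces\<close>

lemma set_integrable_continuous_dominated:
  fixes k :: "complex \<Rightarrow> 'a::euclidean_space" and u :: "complex \<Rightarrow> 'b::euclidean_space"
  assumes "open S" "continuous_on S k" "set_integrable lborel S u"
    and "\<And>z. z \<in> S \<Longrightarrow> norm (k z) \<le> norm (u z)"
  shows "set_integrable lborel S k"
proof (rule set_integrable_bound)
  show "set_borel_measurable lborel S k"
    using borel_measurable_continuous_on_indicator[of S k] assms
    by (auto simp: set_borel_measurable_def)
qed (use assms in auto)

lemma bergman_holomorphic: "F \<in> bergman_space S \<Longrightarrow> F holomorphic_on S"
  by (simp add: bergman_space_def)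

lemma bergman_mult_cnj_integrable:
  assumes "open S" and F: "F \<in> bergman_space S" and G: "G \<in> bergman_space S"
  shows "set_integrable lborel S (\<lambda>z. F z * cnj (G z))"
proof (rule set_integrable_continuous_dominated)
  show "set_integrable lborel S (\<lambda>z. (norm (F z))\<^sup>2 + (norm (G z))\<^sup>2)"
    using F G by (intro set_integral_add) (auto simp: bergman_space_def)
  show "norm (F z * cnj (G z)) \<le> norm ((norm (F z))\<^sup>2 + (norm (G z))\<^sup>2)" for z
  proof -
    have "0 \<le> (norm (F z))\<^sup>2 + (norm (G z))\<^sup>2"
      by simp
    moreover have "2 * norm (F z) * norm (G z) \<le> (norm (F z))\<^sup>2 + (norm (G z))\<^sup>2"
      by (rule sum_squares_bound)
    moreover have "0 \<le> norm (F z) * norm (G z)"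
      by simp
    ultimately have "norm (F z) * norm (G z) \<le> \<bar>(norm (F z))\<^sup>2 + (norm (G z))\<^sup>2\<bar>"
      by linarith
    then show ?thesis
      by (simp only: norm_mult complex_mod_cnj real_norm_def)
  qed
qed (use assms in \<open>auto intro!: continuous_intros dest!: bergman_holomorphic holomorphic_on_imp_continuous_on\<close>)

lemma bounded_imp_in_bergman:
  assumes S: "open S" "bounded S" and F: "F holomorphic_on S" and B: "\<And>z. z \<in> S \<Longrightarrow> norm (F z) \<le> B"
  shows "F \<in> bergman_space S"
  unfolding bergman_space_def
proof (intro CollectI conjI F)
  have "integrable lborel (\<lambda>z. indicator S z *\<^sub>R B\<^sup>2)"
    using S emeasure_bounded_finite[of S] by (intro integrable_scaleR_left integrable_real_indicator) auto
  then have "set_integrable lborel S (\<lambda>_. B\<^sup>2)"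
    by (simp add: set_integrable_def)
  then show "set_integrable lborel S (\<lambda>z. (norm (F z))\<^sup>2)"
    by (rule set_integrable_continuous_dominated[OF \<open>open S\<close>, rotated])
      (auto intro!: continuous_intros holomorphic_on_imp_continuous_on F power_mono B)
qed

lemma bergman_integrable:
  assumes "open S" "bounded S" "F \<in> bergman_space S"
  shows "set_integrable lborel S F"
  using bergman_mult_cnj_integrable[of S F "\<lambda>_. 1"] bounded_imp_in_bergman[of S "\<lambda>_. 1" 1] assms
  by simp

lemma set_integrable_of_real:
  assumes "set_integrable M A f"
  shows "set_integrable M A (\<lambda>x. complex_of_real (f x))"
proof -
  have "(\<lambda>x. indicator A x *\<^sub>R complex_of_real (f x)) = (\<lambda>x. complex_of_real (indicator A x *\<^sub>R f x))"
    by (simp add: scaleR_conv_of_real)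
  then show ?thesis
    using assms unfolding set_integrable_def by (simp only: complex_of_real_integrable_eq)
qed

lemma bergman_conformal_pullback:
  assumes S: "open S" and g: "g holomorphic_on S" and inj: "inj_on g S"
    and F: "F \<in> bergman_space (g ` S)"
  shows "(\<lambda>z. F (g z) * deriv g z) \<in> bergman_space S"
proof -
  have hol: "(\<lambda>z. F (g z) * deriv g z) holomorphic_on S"
    using holomorphic_on_compose_gen[OF g bergman_holomorphic[OF F]] S g
    by (auto intro!: holomorphic_intros simp: o_def)
  have cont: "continuous_on (g ` S) (\<lambda>w. complex_of_real ((norm (F w))\<^sup>2))"
    by (intro continuous_intros holomorphic_on_imp_continuous_on bergman_holomorphic F)
  have "set_integrable lborel (g ` S) (\<lambda>w. complex_of_real ((norm (F w))\<^sup>2))"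
    using F by (intro set_integrable_of_real) (simp add: bergman_space_def)
  then have "set_integrable lborel S (\<lambda>z. complex_of_real ((norm (deriv g z))\<^sup>2) * complex_of_real ((norm (F (g z)))\<^sup>2))"
    using conformal_change_of_variables(1)[OF S g inj cont] by simp
  then have "set_integrable lborel S (\<lambda>z. (norm (F (g z) * deriv g z))\<^sup>2)"
  proof (rule set_integrable_continuous_dominated[OF S, rotated])
    show "continuous_on S (\<lambda>z. (norm (F (g z) * deriv g z))\<^sup>2)"
      by (rule continuous_on_power[OF continuous_on_norm[OF holomorphic_on_imp_continuous_on[OF hol]]])
  qed (simp add: norm_mult norm_power power_mult_distrib mult.commute)
  with hol show ?thesis
    by (simp add: bergman_space_def)
qed

lemma scaled_in_disc:
  assumes "0 \<le> t" "t \<le> 1" "norm z < 1"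
  shows "norm (complex_of_real t * z) < 1"
  using assms mult_left_le_one_le[of "norm z" t] by (simp add: norm_mult)

lemma bergman_dilation:
  assumes F: "F holomorphic_on ball 0 1" and t: "0 \<le> t" "t < 1"
  shows "(\<lambda>z. F (complex_of_real t * z)) \<in> bergman_space (ball 0 1)"
proof -
  have "continuous_on (cball 0 t) F"
    using F t by (intro holomorphic_on_imp_continuous_on) (auto elim: holomorphic_on_subset)
  then have "bounded (F ` cball 0 t)"
    by (intro compact_imp_bounded compact_continuous_image) auto
  then obtain B where B: "\<And>w. w \<in> cball 0 t \<Longrightarrow> norm (F w) \<le> B"
    unfolding bounded_iff by blast
  have "(\<lambda>z. F (complex_of_real t * z)) holomorphic_on ball 0 1"
    using t scaled_in_disc[of t]
    by (intro holomorphic_on_compose_gen[OF _ F, unfolded o_def] holomorphic_intros) auto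
  moreover have "complex_of_real t * z \<in> cball 0 t" if "z \<in> ball 0 1" for z
    using that t by (simp add: norm_mult mult_left_le)
  ultimately show ?thesis
    using B by (intro bounded_imp_in_bergman[where B = B]) auto
qed

lemma disc_dilation_selfadjoint:
  assumes F: "F \<in> bergman_space (ball 0 1)" and G: "G \<in> bergman_space (ball 0 1)"
    and t: "0 \<le> t" "t < 1"
  shows "(LINT z:ball 0 1|lborel. F (complex_of_real t * z) * cnj (G z)) =
    (LINT z:ball 0 1|lborel. F z * cnj (G (complex_of_real t * z)))"
proof -
  define r :: "nat \<Rightarrow> real" where "r n = 1 - 1 / real (n + 2)" for n
  have r: "0 < r n" "r n < 1" for n
    by (auto simp: r_def field_simps)
  have mono: "incseq (\<lambda>n. ball (0::complex) (r n))"
    by (intro incseq_SucI subset_ball) (simp add: r_def field_simps)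
  have union: "(\<Union>n. ball (0::complex) (r n)) = ball 0 1"
  proof
    show "ball (0::complex) 1 \<subseteq> (\<Union>n. ball 0 (r n))"
    proof
      fix z :: complex
      assume "z \<in> ball 0 1"
      then obtain n where "n \<noteq> 0" "inverse (real n) < 1 - norm z"
        using real_arch_inverse[of "1 - norm z"] by auto
      moreover have "1 / real (n + 2) \<le> inverse (real n)"
        using \<open>n \<noteq> 0\<close> by (simp add: field_simps)
      ultimately have "norm z < r n"
        by (simp add: r_def)
      then show "z \<in> (\<Union>n. ball 0 (r n))"
        by auto
    qed
    show "(\<Union>n. ball (0::complex) (r n)) \<subseteq> ball 0 1"
      using r by (intro UN_least subset_ball less_imp_le)
  qed
  have lim: "(\<lambda>n. LINT z:ball 0 (r n)|lborel. k z) \<longlonglongrightarrow> (LINT z:ball 0 1|lborel. k z)"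
    if "set_integrable lborel (ball 0 1) k" for k :: "complex \<Rightarrow> complex"
    using set_integral_cont_up[of "\<lambda>n. ball 0 (r n)" lborel k] mono that by (simp add: union)
  have Fh: "F holomorphic_on ball 0 1" and Gh: "G holomorphic_on ball 0 1"
    using F G bergman_holomorphic by blast+
  have "(LINT z:ball 0 (r n)|lborel. F (complex_of_real t * z) * cnj (G z)) =
      (LINT z:ball 0 (r n)|lborel. F z * cnj (G (complex_of_real t * z)))" for n
    using t r by (intro disc_dilation_selfadjoint_smaller Fh Gh) auto
  moreover have "(\<lambda>n. LINT z:ball 0 (r n)|lborel. F (complex_of_real t * z) * cnj (G z)) \<longlonglongrightarrow>
      (LINT z:ball 0 1|lborel. F (complex_of_real t * z) * cnj (G z))"
    by (intro lim bergman_mult_cnj_integrable bergman_dilation Fh G t) auto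
  moreover have "(\<lambda>n. LINT z:ball 0 (r n)|lborel. F z * cnj (G (complex_of_real t * z))) \<longlonglongrightarrow>
      (LINT z:ball 0 1|lborel. F z * cnj (G (complex_of_real t * z)))"
    by (intro lim bergman_mult_cnj_integrable bergman_dilation Gh F t) auto
  ultimately show ?thesis
    using LIMSEQ_unique by simp blast
qed

section \<open>Finite combinations of derivative evaluations\<close>

definition point_functional :: "complex set \<Rightarrow> ((complex \<Rightarrow> complex) \<Rightarrow> complex) \<Rightarrow> bool" where
  "point_functional S L \<longleftrightarrow>
     (\<exists>(Z :: complex set) (N :: nat) (c :: nat \<Rightarrow> complex \<Rightarrow> complex).
        finite Z \<and> Z \<subseteq> S \<and>
        (\<forall>f\<in>bergman_space S. L f = (\<Sum>z\<in>Z. \<Sum>j<N. c j z * (deriv ^^ j) f z)))"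

text \<open>On a bounded set the integrability clause of the definition holds automatically.\<close>

lemma quadrature_domain_altdef:
  assumes "bounded S"
  shows "quadrature_domain S \<longleftrightarrow> domain S \<and> point_functional S (\<lambda>f. LINT z:S|lborel. f z)"
proof (cases "domain S")
  case True
  then have "set_integrable lborel S f" if "f \<in> bergman_space S" for f
    using that assms by (auto simp: domain_def intro: bergman_integrable)
  then show ?thesis
    by (simp add: quadrature_domain_def point_functional_def cong: ball_cong)
qed (simp add: quadrature_domain_def)

lemma point_functional_cong:
  assumes "point_functional S L" "\<And>f. f \<in> bergman_space S \<Longrightarrow> L' f = L f"
  shows "point_functional S L'"
  using assms by (simp add: point_functional_def cong: ball_cong)

lemma point_functional_zero: "point_functional S (\<lambda>_. 0)"
  unfolding point_functional_def by (intro exI[of _ "{}"]) auto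

lemma point_functional_deriv:
  assumes "w \<in> S"
  shows "point_functional S (\<lambda>f. a * (deriv ^^ j) f w)"
  unfolding point_functional_def
proof (intro exI conjI ballI)
  show "a * (deriv ^^ j) f w = (\<Sum>z\<in>{w}. \<Sum>i<Suc j. (if i = j then a else 0) * (deriv ^^ i) f z)" for f
    by simp
qed (use assms in auto)

lemma point_functional_add:
  assumes "point_functional S L" "point_functional S L'"
  shows "point_functional S (\<lambda>f. L f + L' f)"
proof -
  obtain Z N c where Z: "finite Z" "Z \<subseteq> S"
    and L: "\<And>f. f \<in> bergman_space S \<Longrightarrow> L f = (\<Sum>z\<in>Z. \<Sum>j<N. c j z * (deriv ^^ j) f z)"
    using assms(1) unfolding point_functional_def by blast
  obtain Z' N' c' where Z': "finite Z'" "Z' \<subseteq> S"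
    and L': "\<And>f. f \<in> bergman_space S \<Longrightarrow> L' f = (\<Sum>z\<in>Z'. \<Sum>j<N'. c' j z * (deriv ^^ j) f z)"
    using assms(2) unfolding point_functional_def by blast
  define d where "d j z = (if z \<in> Z \<and> j < N then c j z else 0)" for j z
  define d' where "d' j z = (if z \<in> Z' \<and> j < N' then c' j z else 0)" for j z
  have pad: "(\<Sum>z\<in>X. \<Sum>j<K. e j z * (deriv ^^ j) f z) =
      (\<Sum>z\<in>Z \<union> Z'. \<Sum>j<max N N'. (if z \<in> X \<and> j < K then e j z else 0) * (deriv ^^ j) f z)"
    if "X \<subseteq> Z \<union> Z'" "K \<le> max N N'" for X K e f
  proof -
    have "(\<Sum>z\<in>X. \<Sum>j<K. e j z * (deriv ^^ j) f z) =
        (\<Sum>z\<in>X. \<Sum>j<max N N'. (if z \<in> X \<and> j < K then e j z else 0) * (deriv ^^ j) f z)"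
      using that by (intro sum.cong refl sum.mono_neutral_cong_left) auto
    also have "\<dots> = (\<Sum>z\<in>Z \<union> Z'. \<Sum>j<max N N'. (if z \<in> X \<and> j < K then e j z else 0) * (deriv ^^ j) f z)"
      using that Z Z' by (intro sum.mono_neutral_left) auto
    finally show ?thesis .
  qed
  have "L f + L' f = (\<Sum>z\<in>Z \<union> Z'. \<Sum>j<max N N'. (d j z + d' j z) * (deriv ^^ j) f z)"
    if "f \<in> bergman_space S" for f
    using L[OF that] L'[OF that] pad[of Z N c f] pad[of Z' N' c' f]
    by (simp add: d_def d'_def distrib_right sum.distrib)
  then show ?thesis
    unfolding point_functional_def using Z Z'
    by (intro exI[of _ "Z \<union> Z'"] exI[of _ "max N N'"] exI[of _ "\<lambda>j z. d j z + d' j z"]) auto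
qed

lemma point_functional_sum:
  assumes "finite I" "\<And>i. i \<in> I \<Longrightarrow> point_functional S (L i)"
  shows "point_functional S (\<lambda>f. \<Sum>i\<in>I. L i f)"
  using assms by (induction I rule: finite_induct) (auto intro: point_functional_zero point_functional_add)

lemma point_functional_cmult:
  assumes "point_functional S L"
  shows "point_functional S (\<lambda>f. a * L f)"
proof -
  obtain Z N c where Z: "finite Z" "Z \<subseteq> S"
    and L: "\<And>f. f \<in> bergman_space S \<Longrightarrow> L f = (\<Sum>z\<in>Z. \<Sum>j<N. c j z * (deriv ^^ j) f z)"
    using assms unfolding point_functional_def by blast
  have "point_functional S (\<lambda>f. \<Sum>z\<in>Z. \<Sum>j<N. (a * c j z) * (deriv ^^ j) f z)"
    using Z by (intro point_functional_sum point_functional_deriv) auto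
  then show ?thesis
    by (rule point_functional_cong) (simp add: L sum_distrib_left mult.assoc)
qed

lemma higher_deriv_weighted_composition:
  fixes G M :: "complex \<Rightarrow> complex"
  assumes S: "open S" and T: "open T" and G: "G holomorphic_on S" and GT: "G ` S \<subseteq> T"
    and M: "M holomorphic_on S" and z: "z \<in> S"
  shows "\<exists>a. \<forall>h. h holomorphic_on T \<longrightarrow>
    (deriv ^^ j) (\<lambda>u. h (G u) * M u) z = (\<Sum>i\<le>j. a i * (deriv ^^ i) h (G z))"
  using M
proof (induction j arbitrary: M)
  case 0
  show ?case
    by (intro exI[of _ "\<lambda>_. M z"]) auto
next
  case (Suc j)
  have M1: "(\<lambda>u. deriv G u * M u) holomorphic_on S" and M2: "deriv M holomorphic_on S"
    using S G Suc.prems by (auto intro!: holomorphic_intros)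
  obtain a where a: "\<And>h. h holomorphic_on T \<Longrightarrow>
      (deriv ^^ j) (\<lambda>u. h (G u) * (deriv G u * M u)) z = (\<Sum>i\<le>j. a i * (deriv ^^ i) h (G z))"
    using Suc.IH[OF M1] by blast
  obtain b where b: "\<And>h. h holomorphic_on T \<Longrightarrow>
      (deriv ^^ j) (\<lambda>u. h (G u) * deriv M u) z = (\<Sum>i\<le>j. b i * (deriv ^^ i) h (G z))"
    using Suc.IH[OF M2] by blast
  define e where "e i = (if i = 0 then 0 else a (i - 1)) + (if i \<le> j then b i else 0)" for i
  have "(deriv ^^ Suc j) (\<lambda>u. h (G u) * M u) z = (\<Sum>i\<le>Suc j. e i * (deriv ^^ i) h (G z))"
    if h: "h holomorphic_on T" for h
  proof -
    have h': "deriv h holomorphic_on T"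
      using h T by (rule holomorphic_deriv)
    have hG: "(\<lambda>u. h (G u)) holomorphic_on S" and h'G: "(\<lambda>u. deriv h (G u)) holomorphic_on S"
      using holomorphic_on_compose_gen[OF G h GT] holomorphic_on_compose_gen[OF G h' GT] by (auto simp: o_def)
    have der: "deriv (\<lambda>u. h (G u) * M u) u = deriv h (G u) * (deriv G u * M u) + h (G u) * deriv M u"
      if u: "u \<in> S" for u
    proof -
      have "(G has_field_derivative deriv G u) (at u)" "(M has_field_derivative deriv M u) (at u)"
        using u S G Suc.prems by (auto intro: holomorphic_derivI)
      moreover have "(h has_field_derivative deriv h (G u)) (at (G u))"
        using u GT T h by (auto intro: holomorphic_derivI)
      ultimately show ?thesis
        by (intro DERIV_imp_deriv) (auto intro!: derivative_eq_intros DERIV_chain2[of h] simp: algebra_simps)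
    qed
    have "(deriv ^^ Suc j) (\<lambda>u. h (G u) * M u) z = (deriv ^^ j) (deriv (\<lambda>u. h (G u) * M u)) z"
      by (simp only: funpow_Suc_right o_apply)
    also have "\<dots> = (deriv ^^ j) (\<lambda>u. deriv h (G u) * (deriv G u * M u) + h (G u) * deriv M u) z"
      using hG h'G M1 M2 S G Suc.prems z der
      by (intro higher_deriv_transform_within_open[of _ S] holomorphic_intros) auto
    also have "\<dots> = (deriv ^^ j) (\<lambda>u. deriv h (G u) * (deriv G u * M u)) z + (deriv ^^ j) (\<lambda>u. h (G u) * deriv M u) z"
      by (rule higher_deriv_add[OF holomorphic_on_mult[OF h'G M1] holomorphic_on_mult[OF hG M2] S z])
    also have "\<dots> = (\<Sum>i\<le>j. a i * (deriv ^^ Suc i) h (G z)) + (\<Sum>i\<le>j. b i * (deriv ^^ i) h (G z))"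
      using a[OF h'] b[OF h] by (simp only: funpow_Suc_right o_apply)
    also have "(\<Sum>i\<le>j. a i * (deriv ^^ Suc i) h (G z)) =
        (\<Sum>i\<le>Suc j. (if i = 0 then 0 else a (i - 1)) * (deriv ^^ i) h (G z))"
      by (subst sum.atMost_Suc_shift) simp
    also have "(\<Sum>i\<le>j. b i * (deriv ^^ i) h (G z)) =
        (\<Sum>i\<le>Suc j. (if i \<le> j then b i else 0) * (deriv ^^ i) h (G z))"
      by simp
    finally show ?thesis
      unfolding e_def by (simp only: distrib_right sum.distrib)
  qed
  then show ?case
    by blast
qed

lemma point_functional_weighted_composition:
  fixes G M :: "complex \<Rightarrow> complex"
  assumes L: "point_functional S L"
    and S: "open S" and T: "open T" and G: "G holomorphic_on S" and GT: "G ` S \<subseteq> T"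
    and M: "M holomorphic_on S"
    and berg: "\<And>h. h \<in> bergman_space T \<Longrightarrow> (\<lambda>u. h (G u) * M u) \<in> bergman_space S"
  shows "point_functional T (\<lambda>h. L (\<lambda>u. h (G u) * M u))"
proof -
  obtain Z N c where Z: "finite Z" "Z \<subseteq> S"
    and L: "\<And>f. f \<in> bergman_space S \<Longrightarrow> L f = (\<Sum>z\<in>Z. \<Sum>j<N. c j z * (deriv ^^ j) f z)"
    using L unfolding point_functional_def by blast
  have pf: "point_functional T (\<lambda>h. (deriv ^^ j) (\<lambda>u. h (G u) * M u) z)" if z: "z \<in> S" for j z
  proof -
    obtain a where a: "\<And>h. h holomorphic_on T \<Longrightarrow>
        (deriv ^^ j) (\<lambda>u. h (G u) * M u) z = (\<Sum>i\<le>j. a i * (deriv ^^ i) h (G z))"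
      using higher_deriv_weighted_composition[OF S T G GT M z, of j] by blast
    have "point_functional T (\<lambda>h. \<Sum>i\<le>j. a i * (deriv ^^ i) h (G z))"
      using z GT by (intro point_functional_sum point_functional_deriv) auto
    then show ?thesis
      by (rule point_functional_cong) (simp add: a bergman_holomorphic)
  qed
  have "point_functional T (\<lambda>h. \<Sum>z\<in>Z. \<Sum>j<N. c j z * (deriv ^^ j) (\<lambda>u. h (G u) * M u) z)"
    using Z by (intro point_functional_sum point_functional_cmult pf) auto
  then show ?thesis
    by (rule point_functional_cong) (simp add: L berg)
qed

lemma conformal_image_integral:
  assumes S: "open S" "bounded (g ` S)" and g: "g holomorphic_on S" and inj: "inj_on g S"
    and h: "h \<in> bergman_space (g ` S)"
  shows "(LINT w:g ` S|lborel. h w) = (LINT z:S|lborel. h (g z) * deriv g z * cnj (deriv g z))"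
proof -
  have "(LINT w:g ` S|lborel. h w) = (LINT z:S|lborel. of_real ((norm (deriv g z))\<^sup>2) * h (g z))"
    using S g inj h
    by (intro conformal_change_of_variables bergman_integrable open_mapping_thm3)
      (auto intro: holomorphic_on_imp_continuous_on bergman_holomorphic)
  also have "\<dots> = (LINT z:S|lborel. h (g z) * deriv g z * cnj (deriv g z))"
    by (simp only: complex_norm_square mult.assoc mult.commute mult.left_commute)
  finally show ?thesis .
qed

lemma quadrature_imp_disc_functional:
  assumes f: "f holomorphic_on ball 0 1" and inj: "inj_on f (ball 0 1)"
    and bdd: "bounded (f ` ball 0 1)" and quad: "quadrature_domain (f ` ball 0 1)"
  shows "point_functional (ball 0 1) (\<lambda>F. LINT z:ball 0 1|lborel. F z * cnj (deriv f z))"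
proof -
  let ?D = "ball (0::complex) 1" and ?\<Omega> = "f ` ball 0 1"
  have \<Omega>: "open ?\<Omega>"
    using open_mapping_thm3[OF f _ inj] by simp
  obtain p where p: "p holomorphic_on ?\<Omega>" and df: "\<And>z. z \<in> ?D \<Longrightarrow> deriv f z * deriv p (f z) = 1"
    and pf: "\<And>z. z \<in> ?D \<Longrightarrow> p (f z) = z"
    using holomorphic_has_inverse[OF f _ inj] by auto
  have p_img: "p ` ?\<Omega> = ?D"
    using pf by (force simp: image_image)
  have p_inj: "inj_on p ?\<Omega>"
    using pf by (auto simp: inj_on_def)
  have berg: "(\<lambda>w. F (p w) * deriv p w) \<in> bergman_space ?\<Omega>" if "F \<in> bergman_space ?D" for F
    using bergman_conformal_pullback[OF \<Omega> p p_inj] that by (simp add: p_img)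
  have "point_functional ?\<Omega> (\<lambda>h. LINT w:?\<Omega>|lborel. h w)"
    using quad bdd quadrature_domain_altdef by blast
  then have "point_functional ?D (\<lambda>F. LINT w:?\<Omega>|lborel. F (p w) * deriv p w)"
    using \<Omega> p p_img berg by (intro point_functional_weighted_composition[of ?\<Omega>] holomorphic_deriv) auto
  then show ?thesis
  proof (rule point_functional_cong)
    fix F assume "F \<in> bergman_space ?D"
    from conformal_image_integral[OF _ bdd f inj berg[OF this]]
    have "(LINT w:?\<Omega>|lborel. F (p w) * deriv p w) =
        (LINT z:?D|lborel. F (p (f z)) * deriv p (f z) * deriv f z * cnj (deriv f z))"
      by simp
    also have "\<dots> = (LINT z:?D|lborel. F z * cnj (deriv f z))"
    proof (intro set_lebesgue_integral_cong allI impI)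
      fix z assume z: "z \<in> ?D"
      have "F (p (f z)) * deriv p (f z) * deriv f z * cnj (deriv f z) =
          F z * (deriv f z * deriv p (f z)) * cnj (deriv f z)"
        using pf[OF z] by simp
      also have "\<dots> = F z * cnj (deriv f z)"
        using df[OF z] by simp
      finally show "F (p (f z)) * deriv p (f z) * deriv f z * cnj (deriv f z) = F z * cnj (deriv f z)" .
    qed auto
    finally show "(LINT z:?D|lborel. F z * cnj (deriv f z)) = (LINT w:?\<Omega>|lborel. F (p w) * deriv p w)"
      by simp
  qed
qed

lemma disc_functional_imp_quadrature:
  assumes g: "g holomorphic_on ball 0 1" and inj: "inj_on g (ball 0 1)" and bdd: "bounded (g ` ball 0 1)"
    and pf: "point_functional (ball 0 1) (\<lambda>F. LINT z:ball 0 1|lborel. F z * cnj (deriv g z))"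
  shows "quadrature_domain (g ` ball 0 1)"
proof -
  let ?D = "ball (0::complex) 1" and ?\<Omega> = "g ` ball 0 1"
  have \<Omega>: "open ?\<Omega>"
    using open_mapping_thm3[OF g _ inj] by simp
  moreover have "connected ?\<Omega>"
    by (intro connected_continuous_image holomorphic_on_imp_continuous_on g) auto
  ultimately have dom: "domain ?\<Omega>"
    by (auto simp: domain_def)
  have "point_functional ?\<Omega> (\<lambda>h. LINT z:?D|lborel. h (g z) * deriv g z * cnj (deriv g z))"
    using g \<Omega> inj by (intro point_functional_weighted_composition[OF pf] holomorphic_deriv bergman_conformal_pullback) auto
  then have "point_functional ?\<Omega> (\<lambda>h. LINT w:?\<Omega>|lborel. h w)"
    by (rule point_functional_cong) (use conformal_image_integral[OF _ bdd g inj] in simp)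
  with dom bdd show ?thesis
    using quadrature_domain_altdef by blast
qed

lemma disc_functional_dilation:
  assumes G: "G \<in> bergman_space (ball 0 1)" and t: "0 \<le> t" "t < 1"
    and pf: "point_functional (ball 0 1) (\<lambda>F. LINT z:ball 0 1|lborel. F z * cnj (G z))"
  shows "point_functional (ball 0 1) (\<lambda>F. LINT z:ball 0 1|lborel. F z * cnj (G (complex_of_real t * z)))"
proof -
  have "point_functional (ball 0 1) (\<lambda>F. LINT z:ball 0 1|lborel. F (complex_of_real t * z) * 1 * cnj (G z))"
    using t bergman_dilation[OF bergman_holomorphic t] scaled_in_disc[of t]
    by (intro point_functional_weighted_composition[OF pf] holomorphic_intros) auto
  then show ?thesis
    by (rule point_functional_cong) (use disc_dilation_selfadjoint[OF _ G t] in simp)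
qed

section \<open>Dilations of a conformal map\<close>

definition chord_slope :: "(complex \<Rightarrow> complex) \<Rightarrow> complex \<Rightarrow> complex" where
  "chord_slope f w = (if w = 0 then deriv f 0 else (f w - f 0) / w)"

definition dilated :: "(complex \<Rightarrow> complex) \<Rightarrow> real \<Rightarrow> complex \<Rightarrow> complex" where
  "dilated f t z = f 0 + z * chord_slope f (complex_of_real t * z)"

lemma dilated_0: "dilated f 0 z = f 0 + deriv f 0 * z"
  by (simp add: dilated_def chord_slope_def)

lemma dilated_pos: "t \<noteq> 0 \<Longrightarrow> dilated f t z = f 0 + (f (complex_of_real t * z) - f 0) / of_real t"
  by (simp add: dilated_def chord_slope_def)

lemma dilated_1: "dilated f 1 z = f z"
  by (simp add: dilated_pos)

lemma continuous_on_chord_slope: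
  assumes f: "f holomorphic_on S" and S: "open S" "0 \<in> S"
  shows "continuous_on S (chord_slope f)"
proof -
  have "isCont (chord_slope f) w" if w: "w \<in> S" for w
  proof (cases "w = 0")
    case True
    have "(f has_field_derivative deriv f 0) (at 0)"
      using f S by (auto intro: holomorphic_derivI)
    then have "((\<lambda>y. (f y - f 0) / y) \<longlongrightarrow> deriv f 0) (at 0)"
      by (simp add: has_field_derivative_iff)
    moreover have "eventually (\<lambda>y. chord_slope f y = (f y - f 0) / y) (at 0)"
      by (auto simp: chord_slope_def eventually_at_filter)
    ultimately have "(chord_slope f \<longlongrightarrow> deriv f 0) (at 0)"
      by (rule tendsto_cong[THEN iffD2, rotated])
    then show ?thesis
      using True by (simp add: isCont_def chord_slope_def)
  next
    case False
    have "isCont f w"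
      using f S w by (meson continuous_on_eq_continuous_at holomorphic_on_imp_continuous_on)
    then have "isCont (\<lambda>y. (f y - f 0) / y) w"
      using False by (intro continuous_intros) auto
    moreover have "eventually (\<lambda>y. chord_slope f y = (f y - f 0) / y) (nhds w)"
      by (rule eventually_mono[OF t1_space_nhds[OF False]]) (simp add: chord_slope_def)
    ultimately show ?thesis
      by (rule isCont_cong[THEN iffD2, rotated])
  qed
  then show ?thesis
    by (simp add: continuous_at_imp_continuous_on)
qed

lemma continuous_on_dilated:
  assumes f: "f holomorphic_on ball 0 1"
    and a: "continuous_on A a" "\<And>x. x \<in> A \<Longrightarrow> 0 \<le> a x \<and> a x \<le> 1"
    and b: "continuous_on A b" "\<And>x. x \<in> A \<Longrightarrow> norm (b x) < 1"
  shows "continuous_on A (\<lambda>x. dilated f (a x) (b x))"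
proof -
  have "continuous_on A (\<lambda>x. chord_slope f (complex_of_real (a x) * b x))"
  proof (rule continuous_on_compose2[OF continuous_on_chord_slope[OF f]])
    show "continuous_on A (\<lambda>x. complex_of_real (a x) * b x)"
      by (intro continuous_intros a b)
    show "(\<lambda>x. complex_of_real (a x) * b x) ` A \<subseteq> ball 0 1"
      using a(2) b(2) scaled_in_disc by auto
  qed auto
  then show ?thesis
    unfolding dilated_def by (intro continuous_intros b)
qed

lemma has_field_derivative_dilated:
  assumes f: "f holomorphic_on ball 0 1" and t: "0 \<le> t" "t \<le> 1" and z: "norm z < 1"
  shows "(dilated f t has_field_derivative deriv f (complex_of_real t * z)) (at z)"
proof (cases "t = 0")
  case True
  then show ?thesis
    by (auto simp: dilated_0[abs_def] intro!: derivative_eq_intros)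
next
  case False
  have "(f has_field_derivative deriv f (complex_of_real t * z)) (at (complex_of_real t * z))"
    using f scaled_in_disc[OF t z] by (auto intro: holomorphic_derivI)
  from DERIV_chain2[where g = "\<lambda>z. complex_of_real t * z" and Db = "of_real t" and x = z, OF this]
  have "((\<lambda>z. f (complex_of_real t * z)) has_field_derivative deriv f (complex_of_real t * z) * of_real t) (at z)"
    by (auto intro!: derivative_eq_intros)
  moreover have "dilated f t = (\<lambda>z. f 0 + (f (complex_of_real t * z) - f 0) / of_real t)"
    using False by (simp add: fun_eq_iff dilated_pos)
  ultimately show ?thesis
    using False by (auto intro!: derivative_eq_intros)
qed

lemma inj_on_dilated:
  assumes f: "f holomorphic_on ball 0 1" and inj: "inj_on f (ball 0 1)" and t: "0 \<le> t" "t \<le> 1"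
  shows "inj_on (dilated f t) (ball 0 1)"
proof (cases "t = 0")
  case True
  then show ?thesis
    using holomorphic_injective_imp_regular[OF f _ inj, of 0] by (auto simp: inj_on_def dilated_0)
next
  case False
  show ?thesis
  proof (rule inj_onI)
    fix x y :: complex
    assume xy: "x \<in> ball 0 1" "y \<in> ball 0 1" and "dilated f t x = dilated f t y"
    then have "f (complex_of_real t * x) = f (complex_of_real t * y)"
      using False by (simp add: dilated_pos)
    with xy have "complex_of_real t * x = complex_of_real t * y"
      using scaled_in_disc[OF t] inj_onD[OF inj, of "complex_of_real t * x" "complex_of_real t * y"] by simp
    with False show "x = y"
      by simp
  qed
qed

lemma holomorphic_on_dilated:
  assumes "f holomorphic_on ball 0 1" "0 \<le> t" "t \<le> 1"
  shows "dilated f t holomorphic_on ball 0 1"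
proof (rule holomorphic_onI)
  fix z :: complex
  assume "z \<in> ball 0 1"
  then have "(dilated f t has_field_derivative deriv f (complex_of_real t * z)) (at z)"
    using assms by (intro has_field_derivative_dilated) auto
  then show "dilated f t field_differentiable at z within ball 0 1"
    unfolding field_differentiable_def using has_field_derivative_at_within by blast
qed

lemma bergman_deriv:
  assumes f: "f holomorphic_on ball 0 1" and inj: "inj_on f (ball 0 1)" and bdd: "bounded (f ` ball 0 1)"
  shows "deriv f \<in> bergman_space (ball 0 1)"
proof -
  have "(\<lambda>_. 1) \<in> bergman_space (f ` ball 0 1)"
    using open_mapping_thm3[OF f _ inj] bdd by (intro bounded_imp_in_bergman[where B = 1]) auto
  from bergman_conformal_pullback[OF _ f inj this] show ?thesis
    by simp
qed

lemma bounded_dilated_image: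
  assumes f: "f holomorphic_on ball 0 1" and t: "0 \<le> t" "t < 1"
  shows "bounded (dilated f t ` ball 0 1)"
proof -
  have "continuous_on (cball 0 t) (chord_slope f)"
    using t by (intro continuous_on_subset[OF continuous_on_chord_slope[OF f]]) auto
  then have "bounded (chord_slope f ` cball 0 t)"
    by (intro compact_imp_bounded compact_continuous_image) auto
  then obtain B where B: "\<And>w. w \<in> cball 0 t \<Longrightarrow> norm (chord_slope f w) \<le> B"
    unfolding bounded_iff by blast
  have "norm (dilated f t z) \<le> norm (f 0) + 1 * B" if z: "z \<in> ball 0 1" for z
  proof -
    have "norm (chord_slope f (complex_of_real t * z)) \<le> B"
      using z t by (intro B) (simp add: norm_mult mult_left_le)
    then have "norm (z * chord_slope f (complex_of_real t * z)) \<le> 1 * B"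
      unfolding norm_mult using z by (intro mult_mono) auto
    then show ?thesis
      unfolding dilated_def by (intro norm_triangle_le) simp
  qed
  then show ?thesis
    unfolding bounded_iff by blast
qed

lemma disc_functional_dilated_deriv:
  assumes f: "f holomorphic_on ball 0 1" and inj: "inj_on f (ball 0 1)"
    and bdd: "bounded (f ` ball 0 1)" and quad: "quadrature_domain (f ` ball 0 1)"
    and t: "0 \<le> t" "t < 1"
  shows "point_functional (ball 0 1)
    (\<lambda>F. LINT z:ball 0 1|lborel. F z * cnj (deriv f (complex_of_real t * z)))"
  using assms by (intro disc_functional_dilation bergman_deriv quadrature_imp_disc_functional)

lemma quadrature_domain_dilated:
  assumes f: "f holomorphic_on ball 0 1" and inj: "inj_on f (ball 0 1)"
    and bdd: "bounded (f ` ball 0 1)" and quad: "quadrature_domain (f ` ball 0 1)"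
    and t: "0 \<le> t" "t \<le> 1"
  shows "quadrature_domain (dilated f t ` ball 0 1)"
proof (cases "t = 1")
  case True
  then show ?thesis
    using quad by (simp add: dilated_1)
next
  case False
  with t have t1: "t < 1"
    by simp
  show ?thesis
  proof (rule disc_functional_imp_quadrature)
    have "deriv (dilated f t) z = deriv f (complex_of_real t * z)" if "z \<in> ball 0 1" for z
      using that by (intro DERIV_imp_deriv has_field_derivative_dilated f t) auto
    then have "(LINT z:ball 0 1|lborel. F z * cnj (deriv (dilated f t) z)) =
        (LINT z:ball 0 1|lborel. F z * cnj (deriv f (complex_of_real t * z)))" for F :: "complex \<Rightarrow> complex"
      by (intro set_lebesgue_integral_cong) auto
    then show "point_functional (ball 0 1) (\<lambda>F. LINT z:ball 0 1|lborel. F z * cnj (deriv (dilated f t) z))"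
      using disc_functional_dilated_deriv[OF f inj bdd quad t(1) t1] by simp
  qed (use f inj t t1 in \<open>auto intro: holomorphic_on_dilated inj_on_dilated bounded_dilated_image\<close>)
qed

lemma quadrature_domain_affine_disc:
  assumes f: "f holomorphic_on ball 0 1" and inj: "inj_on f (ball 0 1)"
    and bdd: "bounded (f ` ball 0 1)" and quad: "quadrature_domain (f ` ball 0 1)"
    and l: "l \<noteq> 0"
  shows "quadrature_domain ((\<lambda>z. a + l * z) ` ball 0 1)"
proof (rule disc_functional_imp_quadrature)
  have f0: "deriv f 0 \<noteq> 0"
    using holomorphic_injective_imp_regular[OF f _ inj, of 0] by simp
  have d: "deriv (\<lambda>z. a + l * z) z = l" for z
    by (rule DERIV_imp_deriv) (auto intro!: derivative_eq_intros)
  have "point_functional (ball 0 1) (\<lambda>F. LINT z:ball 0 1|lborel. F z * cnj (deriv f 0))"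
    using disc_functional_dilated_deriv[OF f inj bdd quad, of 0] by simp
  then have "point_functional (ball 0 1) (\<lambda>F. (cnj l / cnj (deriv f 0)) * (LINT z:ball 0 1|lborel. F z * cnj (deriv f 0)))"
    by (rule point_functional_cmult)
  then show "point_functional (ball 0 1) (\<lambda>F. LINT z:ball 0 1|lborel. F z * cnj (deriv (\<lambda>z. a + l * z) z))"
    by (rule point_functional_cong) (simp add: d f0)
  have "norm (a + l * z) \<le> norm a + norm l * 1" if "z \<in> ball 0 1" for z
    using that by (intro norm_triangle_le add_left_mono) (simp add: norm_mult mult_left_le)
  then show "bounded ((\<lambda>z. a + l * z) ` ball 0 1)"
    unfolding bounded_iff by blast
qed (use l in \<open>auto intro!: holomorphic_intros simp: inj_on_def\<close>)

lemma simply_connected_conformal_image: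
  assumes g: "g holomorphic_on S" and S: "open S" "simply_connected S" and inj: "inj_on g S"
  shows "simply_connected (g ` S)"
proof -
  obtain p where p: "p holomorphic_on g ` S" "\<And>z. z \<in> S \<Longrightarrow> p (g z) = z"
    using holomorphic_has_inverse[OF g S(1) inj] by metis
  have "homeomorphism S (g ` S) g p"
    using p g by (intro homeomorphismI holomorphic_on_imp_continuous_on) auto
  then show ?thesis
    using homeomorphic_simply_connected[OF _ S(2)] unfolding homeomorphic_def by blast
qed

lemma quadrature_domain_riemann_map:
  assumes "bounded \<Omega>" "simply_connected \<Omega>" "quadrature_domain \<Omega>"
  obtains f p where "f holomorphic_on ball 0 1" "inj_on f (ball 0 1)" "f ` ball 0 1 = \<Omega>"
    "continuous_on \<Omega> p" "p ` \<Omega> = ball 0 1" "\<And>w. w \<in> \<Omega> \<Longrightarrow> f (p w) = w"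
proof -
  have "open \<Omega>" "\<Omega> \<noteq> {}" "\<Omega> \<noteq> UNIV"
    using assms by (auto simp: quadrature_domain_def domain_def)
  then obtain p f where "p holomorphic_on \<Omega>" and f: "f holomorphic_on ball 0 1"
    and pf: "\<forall>z\<in>\<Omega>. p z \<in> ball 0 1 \<and> f (p z) = z" "\<forall>z\<in>ball 0 1. f z \<in> \<Omega> \<and> p (f z) = z"
    using assms Riemann_mapping_theorem[of \<Omega>] by blast
  show ?thesis
  proof
    show "inj_on f (ball 0 1)"
      using pf by (metis inj_onI)
    show "f ` ball 0 1 = \<Omega>"
      using pf by (intro equalityI subsetI) (blast, metis imageI)
    show "p ` \<Omega> = ball 0 1"
      using pf by (intro equalityI subsetI) (blast, metis imageI)
  qed (use \<open>p holomorphic_on \<Omega>\<close> f pf in \<open>auto intro: holomorphic_on_imp_continuous_on\<close>)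
qed

text \<open>
  With derivatives at \<open>0\<close> that are positive multiples of each other, the straight path between the two
  affine maps never degenerates.
\<close>

lemma rotate_to_aligned_derivative:
  assumes f: "f holomorphic_on ball 0 1" "inj_on f (ball 0 1)" and m: "m \<noteq> 0"
  obtains g r where "g holomorphic_on ball 0 1" "inj_on g (ball 0 1)"
    "g ` ball 0 1 = f ` ball 0 1" "deriv g 0 = complex_of_real r * m" "r > 0"
proof -
  define d where "d = deriv f 0"
  have d: "d \<noteq> 0"
    using holomorphic_injective_imp_regular[OF f(1) _ f(2), of 0] by (simp add: d_def)
  define \<omega> where "\<omega> = (m * of_real (norm d)) / (d * of_real (norm m))"
  have \<omega>: "norm \<omega> = 1"
    using d m by (simp add: \<omega>_def norm_divide norm_mult)
  then have \<omega>0: "\<omega> \<noteq> 0"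
    by auto
  have img: "(*) \<omega> ` ball 0 1 = ball 0 1"
  proof -
    have "z \<in> (*) \<omega> ` ball 0 1" if "z \<in> ball 0 1" for z
      using that \<omega> \<omega>0 by (intro image_eqI[of _ _ "z / \<omega>"]) (auto simp: norm_divide)
    then show ?thesis
      using \<omega> by (auto simp: norm_mult)
  qed
  show ?thesis
  proof
    show "(\<lambda>z. f (\<omega> * z)) holomorphic_on ball 0 1"
      using \<omega> by (intro holomorphic_on_compose_gen[OF _ f(1), unfolded o_def] holomorphic_intros) (auto simp: norm_mult)
    show "inj_on (\<lambda>z. f (\<omega> * z)) (ball 0 1)"
    proof (rule inj_onI)
      fix x y :: complex
      assume "x \<in> ball 0 1" "y \<in> ball 0 1" "f (\<omega> * x) = f (\<omega> * y)"
      then have "\<omega> * x = \<omega> * y"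
        using \<omega> inj_onD[OF f(2), of "\<omega> * x" "\<omega> * y"] by (simp add: norm_mult)
      with \<omega>0 show "x = y"
        by simp
    qed
    show "(\<lambda>z. f (\<omega> * z)) ` ball 0 1 = f ` ball 0 1"
      by (subst (2) img[symmetric]) (simp only: image_image)
    have "(f has_field_derivative d) (at (\<omega> * 0))"
      using f(1) by (auto simp: d_def intro: holomorphic_derivI)
    from DERIV_chain2[where g = "\<lambda>z. \<omega> * z" and Db = \<omega> and x = 0, OF this]
    have "((\<lambda>z. f (\<omega> * z)) has_field_derivative d * \<omega>) (at 0)"
      by (auto intro!: derivative_eq_intros)
    then have "deriv (\<lambda>z. f (\<omega> * z)) 0 = d * \<omega>"
      by (rule DERIV_imp_deriv)
    then show "deriv (\<lambda>z. f (\<omega> * z)) 0 = complex_of_real (norm d / norm m) * m"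
      using d by (simp add: \<omega>_def)
    show "norm d / norm m > 0"
      using d m by simp
  qed
qed

lemma quadrature_domain_homotopy:
  assumes f: "biholomorphism f (ball 0 1) \<Omega>" "f 0 = 0" and bdd: "bounded \<Omega>" and quad: "quadrature_domain \<Omega>"
  shows "\<exists>\<phi> :: real \<Rightarrow> complex \<Rightarrow> complex.
         disc_homotopy \<phi> \<and>
         (\<forall>z\<in>ball 0 1. \<phi> 0 z = deriv f 0 * z) \<and>
         (\<forall>z\<in>ball 0 1. \<phi> 1 z = f z) \<and>
         (\<forall>t\<in>{0..1}. quadrature_domain (\<phi> t ` ball 0 1))"
proof -
  have hol: "f holomorphic_on ball 0 1" and inj: "inj_on f (ball 0 1)" and img: "f ` ball 0 1 = \<Omega>"
    using f by (auto simp: biholomorphism_def bij_betw_def)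
  have "continuous_on ({0..1} \<times> ball 0 1) (\<lambda>x. dilated f (fst x) (snd x))"
    by (intro continuous_on_dilated hol continuous_intros) auto
  then have "disc_homotopy (dilated f)"
    by (simp add: disc_homotopy_def case_prod_beta)
  then show ?thesis
    using f bdd quad img
    by (intro exI[of _ "dilated f"]) (auto simp: dilated_0 dilated_1 intro!: quadrature_domain_dilated hol inj)
qed

lemma quadrature_domain_deformation:
  assumes \<Omega>1: "bounded \<Omega>1" "simply_connected \<Omega>1" "quadrature_domain \<Omega>1"
    and \<Omega>2: "bounded \<Omega>2" "simply_connected \<Omega>2" "quadrature_domain \<Omega>2"
  shows "\<exists>\<Phi> :: real \<Rightarrow> complex \<Rightarrow> complex.
         continuous_deformation \<Phi> \<Omega>1 \<Omega>2 \<and>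
         (\<forall>t\<in>{0..1}. simply_connected (\<Phi> t ` \<Omega>1) \<and> quadrature_domain (\<Phi> t ` \<Omega>1))"
proof -
  let ?D = "ball (0::complex) 1"
  obtain f p where f: "f holomorphic_on ?D" and f_inj: "inj_on f ?D" and f_img: "f ` ?D = \<Omega>1"
    and p: "continuous_on \<Omega>1 p" and p_img: "p ` \<Omega>1 = ?D" and fp: "\<And>w. w \<in> \<Omega>1 \<Longrightarrow> f (p w) = w"
    using quadrature_domain_riemann_map[OF \<Omega>1] by metis
  obtain g0 where g0: "g0 holomorphic_on ?D" "inj_on g0 ?D" and g0_img: "g0 ` ?D = \<Omega>2"
    using quadrature_domain_riemann_map[OF \<Omega>2] by metis
  have df: "deriv f 0 \<noteq> 0"
    using holomorphic_injective_imp_regular[OF f _ f_inj, of 0] by simp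
  obtain g r where g: "g holomorphic_on ?D" and g_inj: "inj_on g ?D" and g_img: "g ` ?D = \<Omega>2"
    and dg: "deriv g 0 = complex_of_real r * deriv f 0" and r: "r > 0"
    using rotate_to_aligned_derivative[OF g0 df] unfolding g0_img by metis
  \<comment> \<open>The clipped parameters carry out the three stages one after the other: \<open>a\<close> shrinks \<open>\<Omega>1\<close> on
      \<open>[0, 1/3]\<close>, \<open>b\<close> moves the disc on \<open>[1/3, 2/3]\<close>, and \<open>c\<close> grows \<open>\<Omega>2\<close> on \<open>[2/3, 1]\<close>.\<close>
  define a b c :: "real \<Rightarrow> real" where
    "a t = max 0 (1 - 3 * t)" and "b t = min 1 (max 0 (3 * t - 1))" and "c t = max 0 (3 * t - 2)" for t
  define \<psi> where "\<psi> t z = of_real (1 - b t) * dilated f (a t) z + of_real (b t) * dilated g (c t) z" for t z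
  have \<psi>: "\<psi> t holomorphic_on ?D \<and> inj_on (\<psi> t) ?D \<and> quadrature_domain (\<psi> t ` ?D)"
    if t: "t \<in> {0..1}" for t
  proof -
    consider "t \<le> 1 / 3" | "1 / 3 \<le> t" "t \<le> 2 / 3" | "2 / 3 \<le> t"
      by linarith
    then show ?thesis
    proof cases
      case 1
      then have "\<psi> t = dilated f (a t)" "0 \<le> a t" "a t \<le> 1"
        using t by (auto simp: \<psi>_def b_def a_def)
      then show ?thesis
        using f f_inj f_img \<Omega>1
        by (simp add: holomorphic_on_dilated inj_on_dilated quadrature_domain_dilated)
    next
      case 2
      define l where "l = of_real ((1 - b t) + b t * r) * deriv f 0"
      have b: "0 \<le> b t" "b t \<le> 1"
        by (auto simp: b_def)
      have "(1 - b t) + b t * r > 0"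
        using b r by (cases "b t = 1") (auto intro: add_pos_nonneg)
      then have l: "l \<noteq> 0"
        using df by (simp add: l_def del: of_real_add of_real_diff of_real_mult)
      have eq: "\<psi> t = (\<lambda>z. (of_real (1 - b t) * f 0 + of_real (b t) * g 0) + l * z)"
        using 2 by (auto simp: \<psi>_def a_def c_def dilated_0 dg l_def algebra_simps)
      show ?thesis
        unfolding eq using l f f_inj f_img \<Omega>1
        by (auto intro!: holomorphic_intros quadrature_domain_affine_disc[of f] simp: inj_on_def)
    next
      case 3
      then have "\<psi> t = dilated g (c t)" "0 \<le> c t" "c t \<le> 1"
        using t by (auto simp: \<psi>_def b_def c_def)
      then show ?thesis
        using g g_inj g_img \<Omega>2
        by (simp add: holomorphic_on_dilated inj_on_dilated quadrature_domain_dilated)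
    qed
  qed
  define \<Phi> where "\<Phi> t w = \<psi> t (p w)" for t w
  have img: "\<Phi> t ` \<Omega>1 = \<psi> t ` ?D" for t
    unfolding \<Phi>_def p_img[symmetric] by (simp add: image_image)
  have cont: "continuous_on ({0..1} \<times> \<Omega>1) (\<lambda>x. \<Phi> (fst x) (snd x))"
  proof -
    have pc: "continuous_on ({0..1::real} \<times> \<Omega>1) (\<lambda>x. p (snd x))"
      by (intro continuous_on_compose2[OF p] continuous_intros) auto
    have pn: "norm (p (snd x)) < 1" if "x \<in> {0..1::real} \<times> \<Omega>1" for x
      using p_img that by auto
    show ?thesis
      unfolding \<Phi>_def \<psi>_def
      by (intro continuous_intros continuous_on_dilated f g pc pn)
        (auto simp: a_def b_def c_def intro!: continuous_intros)
  qed
  have "continuous_deformation \<Phi> \<Omega>1 \<Omega>2"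
    unfolding continuous_deformation_def
  proof (intro conjI ballI)
    show "\<Phi> 0 w = w" if "w \<in> \<Omega>1" for w
      using fp[OF that] by (simp add: \<Phi>_def \<psi>_def a_def b_def dilated_1)
    show "\<Phi> 1 ` \<Omega>1 = \<Omega>2"
      using g_img by (simp add: img) (simp add: \<psi>_def b_def c_def dilated_1)
  qed (use cont in \<open>simp add: case_prod_beta\<close>)
  moreover have "simply_connected (\<Phi> t ` \<Omega>1) \<and> quadrature_domain (\<Phi> t ` \<Omega>1)" if "t \<in> {0..1}" for t
    using \<psi>[OF that] unfolding img
    by (simp add: simply_connected_conformal_image convex_imp_simply_connected)
  ultimately show ?thesis
    by blast
qed

theorem proposition6p1:
  "(\<forall>(\<Omega> :: complex set) (f :: complex \<Rightarrow> complex).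
      bounded \<Omega> \<and> simply_connected \<Omega> \<and> quadrature_domain \<Omega> \<and> 0 \<in> \<Omega> \<and>
      biholomorphism f (ball 0 1) \<Omega> \<and> f 0 = 0 \<longrightarrow>
      (\<exists>\<phi> :: real \<Rightarrow> complex \<Rightarrow> complex.
         disc_homotopy \<phi> \<and>
         (\<forall>z\<in>ball 0 1. \<phi> 0 z = deriv f 0 * z) \<and>
         (\<forall>z\<in>ball 0 1. \<phi> 1 z = f z) \<and>
         (\<forall>t\<in>{0..1}. quadrature_domain (\<phi> t ` ball 0 1)))) \<and>
   (\<forall>\<Omega>1 \<Omega>2 :: complex set.
      bounded \<Omega>1 \<and> simply_connected \<Omega>1 \<and> quadrature_domain \<Omega>1 \<and>
      bounded \<Omega>2 \<and> simply_connected \<Omega>2 \<and> quadrature_domain \<Omega>2 \<longrightarrow>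
      (\<exists>\<Phi> :: real \<Rightarrow> complex \<Rightarrow> complex.
         continuous_deformation \<Phi> \<Omega>1 \<Omega>2 \<and>
         (\<forall>t\<in>{0..1}. simply_connected (\<Phi> t ` \<Omega>1) \<and> quadrature_domain (\<Phi> t ` \<Omega>1))))"
proof (intro conjI allI impI)
  fix \<Omega> f
  assume "bounded \<Omega> \<and> simply_connected \<Omega> \<and> quadrature_domain \<Omega> \<and> 0 \<in> \<Omega> \<and>
      biholomorphism f (ball 0 1) \<Omega> \<and> f 0 = 0"
  then show "\<exists>\<phi>. disc_homotopy \<phi> \<and> (\<forall>z\<in>ball 0 1. \<phi> 0 z = deriv f 0 * z) \<and>
      (\<forall>z\<in>ball 0 1. \<phi> 1 z = f z) \<and> (\<forall>t\<in>{0..1}. quadrature_domain (\<phi> t ` ball 0 1))"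
    by (intro quadrature_domain_homotopy) auto
next
  fix \<Omega>1 \<Omega>2
  assume "bounded \<Omega>1 \<and> simply_connected \<Omega>1 \<and> quadrature_domain \<Omega>1 \<and>
      bounded \<Omega>2 \<and> simply_connected \<Omega>2 \<and> quadrature_domain \<Omega>2"
  then show "\<exists>\<Phi>. continuous_deformation \<Phi> \<Omega>1 \<Omega>2 \<and>
      (\<forall>t\<in>{0..1}. simply_connected (\<Phi> t ` \<Omega>1) \<and> quadrature_domain (\<Phi> t ` \<Omega>1))"
    by (intro quadrature_domain_deformation) auto
qed

end
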